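(* Let $\mathbb{Q}$ be a stationary probability measure on $(\mathbb{R}^{\mathbb{N}},\mathcal{B}(\mathbb{R}^{\mathbb{N}}))$, let $\lambda\in(0,1)$, and let $Y$ be any real random variable on the probability space $(\mathbb{R}^{\mathbb{N}},\mathcal{B}(\mathbb{R}^{\mathbb{N}}),\mathbb{Q})$. Then: (i) $\pi_{\lambda}(Y|\tilde{\mathcal{I}})$ is unique if and only if $\pi_{\lambda}(Y|\mathcal{I}_{\mathbb{Q}})$ is unique; (ii) if $\pi_{\lambda}(Y|\tilde{\mathcal{I}})$ is unique (or equivalently $\pi_{\lambda}(Y|\mathcal{I}_{\mathbb{Q}})$ is unique), then $\pi_{\lambda}(Y|\tilde{\mathcal{I}})=\pi_{\lambda}(Y|\mathcal{I}_{\mathbb{Q}})$ $\mathbb{Q}$-almost surely.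
   Context: $\mathbb{R}^{\mathbb{N}}$ is the set of real sequences $(x_1,x_2,\ldots)$ and $\mathcal{B}(\mathbb{R}^{\mathbb{N}})$ its Borel sigma-field. Let $T\colon\mathbb{R}^{\mathbb{N}}\to\mathbb{R}^{\mathbb{N}}$ be the shift $T((x_1,x_2,\ldots))=(x_2,x_3,\ldots)$. A probability measure $\mathbb{Q}$ is stationary if $\mathbb{Q}(T^{-1}B)=\mathbb{Q}(B)$ for all $B\in\mathcal{B}(\mathbb{R}^{\mathbb{N}})$. A set $B\in\mathcal{B}(\mathbb{R}^{\mathbb{N}})$ is invariant if $B=T^{-1}B$, and almost invariant for $\mathbb{Q}$ if $\mathbb{Q}((B\setminus T^{-1}B)\cup(T^{-1}B\setminus B))=0$. $\tilde{\mathcal{I}}$ denotes the class of all invariant sets and $\mathcal{I}_{\mathbb{Q}}$ the class of all almost invariant sets for $\mathbb{Q}$; both are sigma-fields. Conditional quantile: let $X$ be a real random variable on a probability space $(\Omega,\mathcal{F},\mathbb{P})$, $\mathcal{G}\subseteq\mathcal{F}$ a sigma-field and $\lambda\in(0,1)$. A random variable $Q_\lambda$ is called (a version of) a conditional $\lambda$th quantile of $X$ with respect to $\mathcal{G}$, denoted $\pi_\lambda(X|\mathcal{G})$, if (i) $Q_\lambda$ is $\mathcal{G}$-measurable and (ii) $\mathbb{P}(X\ge Q_\lambda|\mathcal{G})\ge 1-\lambda$ and $\mathbb{P}(X\le Q_\lambda|\mathcal{G})\ge\lambda$ almost surely. At least one version always exists. $\pi_\lambda(X|\mathcal{G})$ is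 called unique if any two versions of it are almost surely equal. *)

theory Defs
  imports "HOL-Probability.Probability"
begin

text \<open>
  The space of real sequences is the type \<^typ>\<open>nat \<Rightarrow> real\<close> (coordinates indexed from 0),
  and its Borel sigma-field, for the product topology, is the library's \<^const>\<open>borel\<close>.
\<close>

definition seq_shift :: "(nat \<Rightarrow> real) \<Rightarrow> (nat \<Rightarrow> real)" where
  "seq_shift x = (\<lambda>n. x (Suc n))"

definition stationary :: "(nat \<Rightarrow> real) measure \<Rightarrow> bool" where
  "stationary Q \<longleftrightarrow> (\<forall>B\<in>sets borel. emeasure Q (seq_shift -` B) = emeasure Q B)"

definition invariant_sets :: "(nat \<Rightarrow> real) set set" where
  "invariant_sets = {B \<in> sets borel. B = seq_shift -` B}"

definition almost_invariant_sets :: "(nat \<Rightarrow> real) measure \<Rightarrow> (nat \<Rightarrow> real) set set" where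
  "almost_invariant_sets Q =
     {B \<in> sets borel. emeasure Q ((B - seq_shift -` B) \<union> (seq_shift -` B - B)) = 0}"

text \<open>
  The library represents a sub-sigma-field by a measure of which only the space and the measurable
  sets matter.  The generated sigma-fields below add no sets to the generating classes; see
  \<open>sets_inv_field\<close> and \<open>sets_almost_inv_field\<close>.
\<close>

definition inv_field :: "(nat \<Rightarrow> real) measure" where
  "inv_field = sigma UNIV invariant_sets"

definition almost_inv_field :: "(nat \<Rightarrow> real) measure \<Rightarrow> (nat \<Rightarrow> real) measure" where
  "almost_inv_field Q = sigma UNIV (almost_invariant_sets Q)"

text \<open>The conditional probability of an event is the conditional expectation of its indicator.\<close>

definition is_cond_quantile ::
    "'a measure \<Rightarrow> 'a measure \<Rightarrow> real \<Rightarrow> ('a \<Rightarrow> real) \<Rightarrow> ('a \<Rightarrow> real) \<Rightarrow> bool" where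
  "is_cond_quantile M G lam X q \<longleftrightarrow>
     q \<in> borel_measurable G \<and>
     (AE w in M. real_cond_exp M G (indicator {v \<in> space M. X v \<ge> q v}) w \<ge> 1 - lam) \<and>
     (AE w in M. real_cond_exp M G (indicator {v \<in> space M. X v \<le> q v}) w \<ge> lam)"

definition cond_quantile_unique ::
    "'a measure \<Rightarrow> 'a measure \<Rightarrow> real \<Rightarrow> ('a \<Rightarrow> real) \<Rightarrow> bool" where
  "cond_quantile_unique M G lam X \<longleftrightarrow>
     (\<forall>q q'. is_cond_quantile M G lam X q \<longrightarrow> is_cond_quantile M G lam X q' \<longrightarrow>
        (AE w in M. q w = q' w))"

lemma measurable_seq_shift [measurable]: "seq_shift \<in> borel \<rightarrow>\<^sub>M borel"
  by (rule borel_measurable_continuous_onI)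
     (auto simp: seq_shift_def intro!: continuous_intros continuous_on_coordinatewise_then_product)

lemma vimage_seq_shift_in_borel: "B \<in> sets borel \<Longrightarrow> seq_shift -` B \<in> sets borel"
  using measurable_sets[OF measurable_seq_shift, of B] by simp

lemma sigma_algebra_invariant_sets: "sigma_algebra UNIV invariant_sets"
proof -
  have "UNIV - B \<in> invariant_sets" if "B \<in> invariant_sets" for B
    using that by (auto simp: invariant_sets_def Compl_eq_Diff_UNIV[symmetric])
  moreover have "(\<Union>i. A i) \<in> invariant_sets" if "range A \<subseteq> invariant_sets" for A :: "nat \<Rightarrow> _"
  proof -
    have "A i \<in> sets borel" "A i = seq_shift -` A i" for i
      using that by (auto simp: invariant_sets_def)
    then show ?thesis
      by (simp add: invariant_sets_def vimage_UN flip: \<open>\<And>i. A i = seq_shift -` A i\<close>)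
  qed
  moreover have "{} \<in> invariant_sets"
    by (simp add: invariant_sets_def)
  ultimately show ?thesis
    by (simp add: sigma_algebra_iff2)
qed

lemma sets_inv_field: "sets inv_field = invariant_sets"
  unfolding inv_field_def
  by (rule sigma_algebra.sets_measure_of_eq[OF sigma_algebra_invariant_sets])

lemma sigma_algebra_almost_invariant_sets:
  assumes "sets Q = sets borel"
  shows "sigma_algebra UNIV (almost_invariant_sets Q)"
proof -
  have null: "B \<in> almost_invariant_sets Q \<longleftrightarrow>
      B \<in> sets borel \<and> (B - seq_shift -` B) \<union> (seq_shift -` B - B) \<in> null_sets Q" for B
    using assms vimage_seq_shift_in_borel[of B]
    by (auto simp: almost_invariant_sets_def null_sets_def)
  have "UNIV - B \<in> almost_invariant_sets Q" if "B \<in> almost_invariant_sets Q" for B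
  proof -
    have "((UNIV - B) - seq_shift -` (UNIV - B)) \<union> (seq_shift -` (UNIV - B) - (UNIV - B))
        = (B - seq_shift -` B) \<union> (seq_shift -` B - B)"
      by auto
    then show ?thesis
      using that by (auto simp: almost_invariant_sets_def Compl_eq_Diff_UNIV[symmetric])
  qed
  moreover have "(\<Union>i. A i) \<in> almost_invariant_sets Q"
    if A: "range A \<subseteq> almost_invariant_sets Q" for A :: "nat \<Rightarrow> _"
  proof -
    let ?U = "\<Union>i. A i" and ?N = "\<Union>i. (A i - seq_shift -` A i) \<union> (seq_shift -` A i - A i)"
    have *: "A i \<in> sets borel" "(A i - seq_shift -` A i) \<union> (seq_shift -` A i - A i) \<in> null_sets Q" for i
      using A null by blast+
    have U: "?U \<in> sets borel"
      using *(1) by blast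
    have "?N \<in> null_sets Q"
      using *(2) by (rule null_sets_UN)
    moreover have "(?U - seq_shift -` ?U) \<union> (seq_shift -` ?U - ?U) \<in> sets Q"
      using U vimage_seq_shift_in_borel[OF U] assms by auto
    ultimately have "(?U - seq_shift -` ?U) \<union> (seq_shift -` ?U - ?U) \<in> null_sets Q"
      by (rule null_sets_subset) auto
    with U null show ?thesis
      by blast
  qed
  moreover have "{} \<in> almost_invariant_sets Q"
    by (simp add: almost_invariant_sets_def)
  ultimately show ?thesis
    by (simp add: sigma_algebra_iff2)
qed

lemma sets_almost_inv_field:
  assumes "sets Q = sets borel"
  shows "sets (almost_inv_field Q) = almost_invariant_sets Q"
  unfolding almost_inv_field_def
  by (rule sigma_algebra.sets_measure_of_eq[OF sigma_algebra_almost_invariant_sets[OF assms]])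

lemma subalgebra_inv_field:
  assumes "sets Q = sets borel"
  shows "subalgebra Q inv_field"
  using assms sets_eq_imp_space_eq[OF assms]
  by (auto simp: subalgebra_def sets_inv_field invariant_sets_def)
     (auto simp: inv_field_def space_measure_of_conv)

lemma subalgebra_almost_inv_field:
  assumes "sets Q = sets borel"
  shows "subalgebra Q (almost_inv_field Q)"
  using assms sets_eq_imp_space_eq[OF assms]
  by (auto simp: subalgebra_def sets_almost_inv_field almost_invariant_sets_def)
     (auto simp: almost_inv_field_def space_measure_of_conv)

end

theory Submission
  imports Defs
begin

text \<open>
  An almost invariant random variable \<open>q\<close> satisfies \<open>q \<circ> T = q\<close> almost surely, hence by stationarity
  \<open>q \<circ> T\<^sup>n = q\<close> for all \<open>n\<close> almost surely, so that it agrees almost surely with the strictly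
  invariant variable \<open>limsup\<^sub>n q \<circ> T\<^sup>n\<close>.  Consequently conditional expectations with respect to the
  two sigma-fields coincide almost surely, and the conditional quantiles with respect to them are the
  same up to almost sure equality.
\<close>

text \<open>By \<open>repr\<close>, the conditional expectation of \<open>f\<close> given
  \<open>G\<close> has an almost surely equal \<open>F\<close>-measurable copy \<open>h\<close>.
  Conditioning \<open>h\<close> on \<open>F\<close> returns \<open>h\<close>, while the tower
  property turns the same quantity into the conditional expectation of \<open>f\<close> given
  \<open>F\<close>.\<close>

lemma real_cond_exp_AE_eq_subalg:
  assumes fin: "finite_measure M"
    and MG: "subalgebra M G" and GF: "subalgebra G F"
    and repr: "\<And>g :: 'a \<Rightarrow> real. g \<in> borel_measurable G \<Longrightarrow>
      \<exists>h \<in> borel_measurable F. AE x in M. h x = g x"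
    and f: "integrable M f"
  shows "AE x in M. real_cond_exp M F f x = real_cond_exp M G f x"
proof -
  have MF: "subalgebra M F"
    using MG GF by (auto simp: subalgebra_def)
  interpret F: finite_measure_subalgebra M F
    by (rule finite_measure_subalgebra.intro[OF fin]) (unfold_locales, rule MF)
  interpret G: finite_measure_subalgebra M G
    by (rule finite_measure_subalgebra.intro[OF fin]) (unfold_locales, rule MG)
  let ?g = "real_cond_exp M G f"
  obtain h where h: "h \<in> borel_measurable F" and hg: "AE x in M. h x = ?g x"
    using repr[OF borel_measurable_cond_exp] by blast
  have hM: "h \<in> borel_measurable M"
    by (rule measurable_from_subalg[OF MF h])
  have gM: "?g \<in> borel_measurable M"
    by (rule borel_measurable_cond_exp2)
  have "integrable M h"
    using integrable_cong_AE[OF hM gM hg] G.real_cond_exp_int(1)[OF f] by simp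
  then have "AE x in M. real_cond_exp M F h x = h x"
    by (rule F.real_cond_exp_F_meas[OF _ h])
  moreover have "AE x in M. real_cond_exp M F h x = real_cond_exp M F ?g x"
    by (rule F.real_cond_exp_cong[OF hg hM gM])
  moreover have "AE x in M. real_cond_exp M F ?g x = real_cond_exp M F f x"
    by (rule F.real_cond_exp_nested_subalg[OF MG GF f])
  ultimately show ?thesis
    using hg by eventually_elim simp
qed

text \<open>Passing from \<open>q\<close> to \<open>h\<close> alters the two defining events only by
  null sets, and \<open>ce\<close> then exchanges the conditioning fields. No inclusion between
  \<open>F\<close> and \<open>G\<close> is assumed, so the transfer works in both
  directions.\<close>

lemma is_cond_quantile_cong_AE:
  assumes fin: "finite_measure M"
    and MF: "subalgebra M F" and MG: "subalgebra M G"
    and ce: "\<And>f. integrable M f \<Longrightarrow> AE x in M. real_cond_exp M F f x = real_cond_exp M G f x"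
    and X: "X \<in> borel_measurable M"
    and q: "is_cond_quantile M G lam X q"
    and h: "h \<in> borel_measurable F" and hq: "AE x in M. h x = q x"
  shows "is_cond_quantile M F lam X h"
proof -
  interpret finite_measure M by (rule fin)
  interpret F: finite_measure_subalgebra M F
    by unfold_locales (rule MF)
  have hM[measurable]: "h \<in> borel_measurable M"
    by (rule measurable_from_subalg[OF MF h])
  have qM[measurable]: "q \<in> borel_measurable M"
    using measurable_from_subalg[OF MG] q by (auto simp: is_cond_quantile_def)
  note X[measurable]
  have eq: "AE x in M. real_cond_exp M F (indicator {v \<in> space M. P (X v) (h v)}) x
      = real_cond_exp M G (indicator {v \<in> space M. P (X v) (q v)}) x"
    if [measurable]: "{v \<in> space M. P (X v) (h v)} \<in> sets M" "{v \<in> space M. P (X v) (q v)} \<in> sets M"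
    for P
  proof -
    let ?H = "indicator {v \<in> space M. P (X v) (h v)} :: 'a \<Rightarrow> real"
    let ?Q = "indicator {v \<in> space M. P (X v) (q v)} :: 'a \<Rightarrow> real"
    have "AE x in M. ?H x = ?Q x"
      using hq by eventually_elim (auto simp: indicator_def)
    then have "AE x in M. real_cond_exp M F ?H x = real_cond_exp M F ?Q x"
      by (rule F.real_cond_exp_cong) auto
    moreover have "AE x in M. real_cond_exp M F ?Q x = real_cond_exp M G ?Q x"
      by (rule ce) (simp add: integrable_indicator_iff less_top[symmetric])
    ultimately show ?thesis
      by eventually_elim simp
  qed
  have ge: "AE x in M. real_cond_exp M F (indicator {v \<in> space M. X v \<ge> h v}) x
      = real_cond_exp M G (indicator {v \<in> space M. X v \<ge> q v}) x"
    by (rule eq[of "(\<ge>)"]) measurable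
  have le: "AE x in M. real_cond_exp M F (indicator {v \<in> space M. X v \<le> h v}) x
      = real_cond_exp M G (indicator {v \<in> space M. X v \<le> q v}) x"
    by (rule eq[of "(\<le>)"]) measurable
  have "AE x in M. real_cond_exp M G (indicator {v \<in> space M. X v \<ge> q v}) x \<ge> 1 - lam"
    "AE x in M. real_cond_exp M G (indicator {v \<in> space M. X v \<le> q v}) x \<ge> lam"
    using q by (auto simp: is_cond_quantile_def)
  then have "AE x in M. real_cond_exp M F (indicator {v \<in> space M. X v \<ge> h v}) x \<ge> 1 - lam"
    "AE x in M. real_cond_exp M F (indicator {v \<in> space M. X v \<le> h v}) x \<ge> lam"
    using ge le by (auto elim: AE_mp)
  with h show ?thesis
    by (simp add: is_cond_quantile_def)
qed

text \<open>Each sublevel set of \<open>q\<close> is almost invariant. Restricting to rational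
  levels leaves countably many null sets to discard, and a rational level still separates any two
  distinct values.\<close>

lemma almost_invariant_AE_shift:
  assumes Q: "sets Q = sets borel"
    and q: "(q :: (nat \<Rightarrow> real) \<Rightarrow> real) \<in> borel_measurable (almost_inv_field Q)"
  shows "AE x in Q. q (seq_shift x) = q x"
proof -
  have spaces: "space Q = UNIV" "space (almost_inv_field Q) = UNIV"
    using sets_eq_imp_space_eq[OF Q] subalgebra_almost_inv_field[OF Q] by (auto simp: subalgebra_def)
  have "AE x in Q. \<forall>r\<in>\<rat>. q x < r \<longleftrightarrow> q (seq_shift x) < r"
  proof (rule AE_ball_countable'[OF _ countable_rat])
    fix r :: real
    let ?B = "{x. q x < r}"
    have "?B \<in> sets (almost_inv_field Q)"
      using borel_measurable_less[OF q, of "\<lambda>_. r"] spaces by simp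
    then have B: "?B \<in> sets borel"
        "emeasure Q ((?B - seq_shift -` ?B) \<union> (seq_shift -` ?B - ?B)) = 0"
      by (auto simp: sets_almost_inv_field[OF Q] almost_invariant_sets_def)
    have "(?B - seq_shift -` ?B) \<union> (seq_shift -` ?B - ?B) \<in> sets Q"
      using B(1) vimage_seq_shift_in_borel[OF B(1)] unfolding Q by blast
    with B(2) have "(?B - seq_shift -` ?B) \<union> (seq_shift -` ?B - ?B) \<in> null_sets Q"
      by blast
    then show "AE x in Q. q x < r \<longleftrightarrow> q (seq_shift x) < r"
      by (rule AE_I') auto
  qed
  then show ?thesis
  proof eventually_elim
    case (elim x)
    show ?case
    proof (rule linorder_cases[of "q (seq_shift x)" "q x"])
      assume "q (seq_shift x) < q x"
      then obtain r where "r \<in> \<rat>" "q (seq_shift x) < r" "r < q x"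
        using Rats_dense_in_real by blast
      with elim show ?thesis by force
    next
      assume "q x < q (seq_shift x)"
      then obtain r where "r \<in> \<rat>" "q x < r" "r < q (seq_shift x)"
        using Rats_dense_in_real by blast
      with elim show ?thesis by force
    qed
  qed
qed

text \<open>Stationarity says that the image measure of \<open>Q\<close> under the shift is
  \<open>Q\<close> itself, so an almost sure property can be pulled back along one shift at a
  time.\<close>

lemma AE_stationary_funpow:
  assumes Q: "sets Q = sets borel" and stat: "stationary Q"
    and P: "AE x in Q. P x"
  shows "AE x in Q. P ((seq_shift ^^ n) x)"
proof (induction n)
  case (Suc n)
  have T: "seq_shift \<in> Q \<rightarrow>\<^sub>M Q"
    using measurable_seq_shift measurable_cong_sets[OF Q Q] by blast
  have "space Q = UNIV"
    using sets_eq_imp_space_eq[OF Q] by simp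
  then have "distr Q Q seq_shift = Q"
    using stat Q by (intro measure_eqI) (auto simp: emeasure_distr[OF T] stationary_def)
  with Suc have "AE x in distr Q Q seq_shift. P ((seq_shift ^^ n) x)"
    by (simp only:)
  \<comment> \<open>The new shift is applied first, hence the iterate is unfolded on the right
    below.\<close>
  then have "AE x in Q. P ((seq_shift ^^ n) (seq_shift x))"
    by (rule AE_distrD[OF T])
  then show ?case
    by (simp add: funpow_Suc_right del: funpow.simps)
qed (simp add: P)

lemma invariant_measurable_inv_field:
  fixes h :: "(nat \<Rightarrow> real) \<Rightarrow> real"
  assumes h: "h \<in> borel_measurable borel" and inv: "\<And>x. h (seq_shift x) = h x"
  shows "h \<in> borel_measurable inv_field"
proof (rule measurableI)
  fix A :: "real set"
  assume "A \<in> sets borel"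
  then have "h -` A \<in> sets borel"
    using measurable_sets[OF h] by simp
  moreover have "h -` A = seq_shift -` (h -` A)"
    by (auto simp: inv)
  moreover have "space inv_field = UNIV"
    by (simp add: inv_field_def space_measure_of_conv)
  ultimately show "h -` A \<inter> space inv_field \<in> sets inv_field"
    by (simp add: sets_inv_field invariant_sets_def)
qed simp

lemma almost_invariant_AE_eq_invariant:
  fixes q :: "(nat \<Rightarrow> real) \<Rightarrow> real"
  assumes Q: "sets Q = sets borel" and stat: "stationary Q"
    and q: "q \<in> borel_measurable (almost_inv_field Q)"
  shows "\<exists>h \<in> borel_measurable inv_field. AE x in Q. h x = q x"
proof (rule bexI)
  txt \<open>The limit superior may be infinite, where \<^const>\<open>real_of_ereal\<close> returns 0; this preserves
    invariance, and does not happen on the almost sure set where the sequence is constant.\<close>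
  define h where "h x = real_of_ereal (limsup (\<lambda>n. ereal (q ((seq_shift ^^ n) x))))" for x
  have "q \<in> borel_measurable Q"
    using measurable_from_subalg[OF subalgebra_almost_inv_field[OF Q] q] .
  then have [measurable]: "q \<in> borel_measurable borel"
    using measurable_cong_sets[OF Q refl] by blast
  have [measurable]: "(seq_shift ^^ n) \<in> borel \<rightarrow>\<^sub>M borel" for n
    by (induction n) (auto simp: id_def intro: measurable_comp)
  have "h \<in> borel_measurable borel"
    unfolding h_def by measurable
  \<comment> \<open>Shifting \<open>x\<close> drops the first term of the sequence, which the limit
    superior ignores. The equality holds at every point, as exact invariance of the preimages under
    \<open>h\<close> demands.\<close>
  moreover have "h (seq_shift x) = h x" for x
    using limsup_shift[of "\<lambda>n. ereal (q ((seq_shift ^^ n) x))"]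
    by (simp add: h_def funpow_Suc_right del: funpow.simps)
  ultimately show "h \<in> borel_measurable inv_field"
    by (rule invariant_measurable_inv_field)
  have "AE x in Q. \<forall>n. q (seq_shift ((seq_shift ^^ n) x)) = q ((seq_shift ^^ n) x)"
    unfolding AE_all_countable
    using AE_stationary_funpow[OF Q stat almost_invariant_AE_shift[OF Q q]] by blast
  then show "AE x in Q. h x = q x"
  proof eventually_elim
    case (elim x)
    have "q ((seq_shift ^^ n) x) = q x" for n
      by (induction n) (simp_all add: elim)
    then show ?case
      by (simp add: h_def Limsup_const)
  qed
qed

lemma subalgebra_almost_inv_field_inv_field:
  assumes "sets Q = sets borel"
  shows "subalgebra (almost_inv_field Q) inv_field"
proof -
  have "invariant_sets \<subseteq> almost_invariant_sets Q"
    by (auto simp: invariant_sets_def almost_invariant_sets_def)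
  then show ?thesis
    using subalgebra_inv_field[OF assms] subalgebra_almost_inv_field[OF assms]
    by (auto simp: subalgebra_def sets_inv_field sets_almost_inv_field[OF assms])
qed

theorem theorem3p1:
  fixes Q :: "(nat \<Rightarrow> real) measure" and lam :: real and Y :: "(nat \<Rightarrow> real) \<Rightarrow> real"
  assumes "prob_space Q"
    and "sets Q = sets borel"
    and "stationary Q"
    and "0 < lam" and "lam < 1"
    and "Y \<in> borel_measurable Q"
  shows "(cond_quantile_unique Q inv_field lam Y \<longleftrightarrow>
            cond_quantile_unique Q (almost_inv_field Q) lam Y) \<and>
         (cond_quantile_unique Q inv_field lam Y \<longrightarrow>
            (\<forall>q q'. is_cond_quantile Q inv_field lam Y q \<longrightarrow>
                    is_cond_quantile Q (almost_inv_field Q) lam Y q' \<longrightarrow>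
                    (AE x in Q. q x = q' x)))"
proof -
  let ?F = inv_field and ?G = "almost_inv_field Q"
  note fin = prob_space.finite_measure[OF assms(1)]
  note QF = subalgebra_inv_field[OF assms(2)] and QG = subalgebra_almost_inv_field[OF assms(2)]
  note GF = subalgebra_almost_inv_field_inv_field[OF assms(2)]
  note repr = almost_invariant_AE_eq_invariant[OF assms(2,3)]
  have FG: "AE x in Q. real_cond_exp Q ?F f x = real_cond_exp Q ?G f x" if "integrable Q f" for f
    by (rule real_cond_exp_AE_eq_subalg[OF fin QG GF repr that])
  have GF': "AE x in Q. real_cond_exp Q ?G f x = real_cond_exp Q ?F f x" if "integrable Q f" for f
    using FG[OF that] by eventually_elim simp
  \<comment> \<open>Since \<open>?F\<close> is contained in \<open>?G\<close>, the same
    \<open>q\<close> serves without modification.\<close>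
  have up: "is_cond_quantile Q ?G lam Y q" if "is_cond_quantile Q ?F lam Y q" for q
  proof (rule is_cond_quantile_cong_AE[OF fin QG QF GF' assms(6) that])
    show "q \<in> borel_measurable ?G"
      using measurable_from_subalg[OF GF] that by (auto simp: is_cond_quantile_def)
  qed auto
  \<comment> \<open>Here \<open>q\<close> may fail to be \<open>?F\<close>-measurable and is
    replaced by its invariant copy.\<close>
  have down: "\<exists>h. is_cond_quantile Q ?F lam Y h \<and> (AE x in Q. h x = q x)"
    if q: "is_cond_quantile Q ?G lam Y q" for q
  proof -
    obtain h where "h \<in> borel_measurable ?F" "AE x in Q. h x = q x"
      using repr q by (auto simp: is_cond_quantile_def)
    then show ?thesis
      using is_cond_quantile_cong_AE[OF fin QF QG FG assms(6) q] by blast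
  qed
  \<comment> \<open>This is claim (ii). It also yields the forward half of (i), once one of two
    \<open>?G\<close>-versions is replaced by its invariant copy.\<close>
  have mixed: "AE x in Q. q x = q' x"
    if u: "cond_quantile_unique Q ?F lam Y"
      and q: "is_cond_quantile Q ?F lam Y q" and q': "is_cond_quantile Q ?G lam Y q'" for q q'
  proof -
    obtain h where h: "is_cond_quantile Q ?F lam Y h" "AE x in Q. h x = q' x"
      using down[OF q'] by blast
    have "AE x in Q. q x = h x"
      using u q h(1) unfolding cond_quantile_unique_def by blast
    with h(2) show ?thesis
      by eventually_elim simp
  qed
  have "cond_quantile_unique Q ?G lam Y" if u: "cond_quantile_unique Q ?F lam Y"
    unfolding cond_quantile_unique_def
  proof (intro allI impI)
    fix q q'
    assume q: "is_cond_quantile Q ?G lam Y q" and q': "is_cond_quantile Q ?G lam Y q'"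
    obtain h where h: "is_cond_quantile Q ?F lam Y h" "AE x in Q. h x = q x"
      using down[OF q] by blast
    from mixed[OF u h(1) q'] h(2) show "AE x in Q. q x = q' x"
      by eventually_elim simp
  qed
  moreover have "cond_quantile_unique Q ?F lam Y" if "cond_quantile_unique Q ?G lam Y"
    using that up unfolding cond_quantile_unique_def by blast
  ultimately show ?thesis
    using mixed by blast
qed

end
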